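(* Let $(w^*,\lambda^* )\in\mathbb{R}^n\times\mathbb{R}^r$ be a local optimum of the problem $$\min_{w,\lambda}\ f(w)\quad\text{s.t.}\quad W\,\nabla_w G(w,\bar\lambda)+p\lambda_1|w|^p=0,\quad \lambda\ge 0,\qquad W:=\mathrm{diag}(w).$$ Suppose that a constraint qualification holds at $(w^*,\lambda^* )$ for the constraint system $$\frac{\partial G(w,\bar\lambda)}{\partial w_i}+p\,\mathrm{sgn}(w_i)\lambda_1|w_i|^{p-1}=0\ (i\notin I(w^* )),\qquad w_i=0\ (i\in I(w^* )),\qquad \lambda\ge 0 .$$ Then there exist $\zeta^*\in\mathbb{R}^n$ and $\eta^*\in\mathbb{R}^r$ such that, with $W_*:=\mathrm{diag}(w^* )$, the following (SB-KKT) conditions hold: $$W_*^2\nabla f(w^* )+H(w^*,\lambda^* )\zeta^*=0,$$ $$W_*\nabla_wG(w^*,\bar\lambda^* )+p\lambda_1^*|w^*|^p=0,$$ $$p\sum_{i\notin I(w^* )}\mathrm{sgn}(w_i^* )|w_i^*|^{p-1}\zeta_i^*=\eta_1^*,$$ $$\zeta_i^*=0\quad(i\in I(w^* )),$$ $$\nabla R_i(w^* )^\top\zeta^*=\eta_i^*\quad(i=2,\ldots,r),$$ $$0\le\lambda^*,\quad 0\le\eta^*,\quad(\lambda^* )^\top\eta^*=0 .$$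
   Context: Setting: $n,r\ge1$ are integers and $0<p\le1$; $f:\mathbb{R}^n\to\mathbb{R}$ is continuously differentiable; $g,R_2,\ldots,R_r:\mathbb{R}^n\to\mathbb{R}$ are twice continuously differentiable. For $\lambda=(\lambda_1,\ldots,\lambda_r)^\top\in\mathbb{R}^r$ write $\bar\lambda:=(\lambda_2,\ldots,\lambda_r)^\top$ and $G(w,\bar\lambda):=g(w)+\sum_{i=2}^r\lambda_iR_i(w)$. Vector inequalities are componentwise. For $w\in\mathbb{R}^n$: $I(w):=\{i\in\{1,\ldots,n\}: w_i=0\}$, $|w|^p:=(|w_1|^p,\ldots,|w_n|^p)^\top$, $\mathrm{sgn}$ is the sign function (with $\mathrm{sgn}(0)=0$), $\mathrm{diag}(v)$ is the diagonal matrix with diagonal $v$, and "$i\notin I(w)$" means $i\in\{1,\ldots,n\}\setminus I(w)$. $H(w,\lambda):=W^2\nabla^2_{ww}G(w,\bar\lambda)+\lambda_1p(p-1)\,\mathrm{diag}(|w|^p)$ with $W=\mathrm{diag}(w)$, where $\nabla^2_{ww}G$ is the Hessian of $G$ with respect to $w$. Constraint qualification: a condition on a constraint system at a feasible point guaranteeing that, for every continuously differentiable objective for which that point is a local minimizer over the feasible set of the system, the Karush-Kuhn-Tucker conditions (existence of Lagrange multipliers) hold at that point. An example is the linear independence constraint qualification (LICQ): the gradients with respect to $(w,\lambda)$ of all equality constraints and of all active inequality constraints at the point are linearly independent. *)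

theory Defs
  imports "HOL-Analysis.Analysis"
begin

section \<open>Smoothness\<close>

definition grad :: "('a::real_inner \<Rightarrow> real) \<Rightarrow> 'a \<Rightarrow> 'a" where
  "grad f x = (THE D. GDERIV f x :> D)"

definition C1_on :: "'a::euclidean_space set \<Rightarrow> ('a \<Rightarrow> real) \<Rightarrow> bool" where
  "C1_on U f \<longleftrightarrow> (\<forall>x\<in>U. f differentiable (at x)) \<and> continuous_on U (grad f)"

definition hessian :: "(real^'n \<Rightarrow> real) \<Rightarrow> real^'n \<Rightarrow> real^'n^'n" where
  "hessian f x = jacobian (grad f) (at x)"

definition C2 :: "(real^'n \<Rightarrow> real) \<Rightarrow> bool" where
  "C2 f \<longleftrightarrow> C1_on UNIV f \<and> (\<forall>x. grad f differentiable (at x)) \<and> continuous_on UNIV (hessian f)"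

section \<open>Constrained optimization\<close>

definition local_minimizer :: "('a::metric_space \<Rightarrow> real) \<Rightarrow> 'a set \<Rightarrow> 'a \<Rightarrow> bool" where
  "local_minimizer F S x \<longleftrightarrow> x \<in> S \<and> (\<exists>e>0. \<forall>y\<in>S. dist y x < e \<longrightarrow> F x \<le> F y)"

text \<open>A constraint system consists of equality constraints \<open>h i x = 0\<close> and inequality
  constraints \<open>c j x \<ge> 0\<close>, indexed by finite types.\<close>

definition feasible_set ::
  "('e \<Rightarrow> 'a \<Rightarrow> real) \<Rightarrow> ('i \<Rightarrow> 'a \<Rightarrow> real) \<Rightarrow> 'a set" where
  "feasible_set h c = {x. (\<forall>i. h i x = 0) \<and> (\<forall>j. 0 \<le> c j x)}"

definition KKT :: "('a::real_inner \<Rightarrow> real) \<Rightarrow> ('e::finite \<Rightarrow> 'a \<Rightarrow> real) \<Rightarrow>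
    ('i::finite \<Rightarrow> 'a \<Rightarrow> real) \<Rightarrow> 'a \<Rightarrow> bool" where
  "KKT F h c x \<longleftrightarrow> x \<in> feasible_set h c \<and>
     (\<exists>\<mu> \<nu>. grad F x + (\<Sum>i\<in>UNIV. \<mu> i *\<^sub>R grad (h i) x) - (\<Sum>j\<in>UNIV. \<nu> j *\<^sub>R grad (c j) x) = 0 \<and>
            (\<forall>j. 0 \<le> \<nu> j) \<and> (\<forall>j. \<nu> j * c j x = 0))"

text \<open>A condition \<open>Q\<close> on a system and a point is a constraint qualification if it guarantees
  the KKT conditions for every continuously differentiable objective. The guarantee is only
  demanded for systems whose constraint functions are continuously differentiable near the
  point; otherwise conditions such as LICQ, which speak about gradients of the constraints,
  would not be constraint qualifications.\<close>

definition constraint_qualification ::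
  "(('e::finite \<Rightarrow> 'a::euclidean_space \<Rightarrow> real) \<Rightarrow> ('i::finite \<Rightarrow> 'a \<Rightarrow> real) \<Rightarrow> 'a \<Rightarrow> bool) \<Rightarrow> bool" where
  "constraint_qualification Q \<longleftrightarrow>
     (\<forall>h c x. x \<in> feasible_set h c \<longrightarrow>
        (\<exists>U. open U \<and> x \<in> U \<and> (\<forall>i. C1_on U (h i)) \<and> (\<forall>j. C1_on U (c j))) \<longrightarrow>
        Q h c x \<longrightarrow>
        (\<forall>F. C1_on UNIV F \<longrightarrow> local_minimizer F (feasible_set h c) x \<longrightarrow> KKT F h c x))"

section \<open>The problem\<close>

definition diag :: "real^'n \<Rightarrow> real^'n^'n" where
  "diag v = (\<chi> i j. if i = j then v $ i else 0)"

definition zero_set :: "real^'n \<Rightarrow> 'n set" where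
  "zero_set w = {i. w $ i = 0}"

definition abs_powr :: "real^'n \<Rightarrow> real \<Rightarrow> real^'n" where
  "abs_powr w p = (\<chi> i. \<bar>w $ i\<bar> powr p)"

text \<open>The vector \<open>l = (l\<^sub>1, \<dots>, l\<^sub>r)\<close> is indexed by an arbitrary finite type \<open>'r\<close> with a
  distinguished index \<open>a\<close> playing the role of 1, so the indices \<open>2, \<dots>, r\<close> are those different
  from \<open>a\<close>; there are none of them if \<open>r = 1\<close>. The value \<open>G a g R w l\<close> does not depend on
  \<open>l $ a\<close> or \<open>R a\<close>.\<close>

definition G :: "'r \<Rightarrow> (real^'n \<Rightarrow> real) \<Rightarrow> ('r \<Rightarrow> real^'n \<Rightarrow> real) \<Rightarrow> real^'n \<Rightarrow> real^'r \<Rightarrow> real" where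
  "G a g R w l = g w + (\<Sum>i\<in>UNIV - {a}. l $ i * R i w)"

definition grad_G ::
  "'r \<Rightarrow> (real^'n \<Rightarrow> real) \<Rightarrow> ('r \<Rightarrow> real^'n \<Rightarrow> real) \<Rightarrow> real^'n \<Rightarrow> real^'r \<Rightarrow> real^'n" where
  "grad_G a g R w l = grad (\<lambda>v. G a g R v l) w"

definition H :: "'r \<Rightarrow> real \<Rightarrow> (real^'n \<Rightarrow> real) \<Rightarrow> ('r \<Rightarrow> real^'n \<Rightarrow> real) \<Rightarrow>
    real^'n \<Rightarrow> real^'r \<Rightarrow> real^'n^'n" where
  "H a p g R w l = diag w ** diag w ** hessian (\<lambda>v. G a g R v l) w
     + (l $ a * p * (p - 1)) *\<^sub>R diag (abs_powr w p)"

definition problem_feasible :: "'r \<Rightarrow> real \<Rightarrow> (real^'n \<Rightarrow> real) \<Rightarrow> ('r \<Rightarrow> real^'n \<Rightarrow> real) \<Rightarrow>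
    ((real^'n) \<times> (real^'r)) set" where
  "problem_feasible a p g R =
     {(w, l). diag w *v grad_G a g R w l + (p * l $ a) *\<^sub>R abs_powr w p = 0 \<and> 0 \<le> l}"

text \<open>The constraint system in which the components of \<open>w\<close> with index in \<open>I\<close> are fixed to 0;
  its equality constraints are indexed by \<open>'n\<close> and its inequality constraints by \<open>'r\<close>.\<close>

definition reduced_eq :: "'r \<Rightarrow> real \<Rightarrow> (real^'n \<Rightarrow> real) \<Rightarrow> ('r \<Rightarrow> real^'n \<Rightarrow> real) \<Rightarrow> 'n set \<Rightarrow>
    'n \<Rightarrow> (real^'n) \<times> (real^'r) \<Rightarrow> real" where
  "reduced_eq a p g R I i = (\<lambda>(w, l). if i \<in> I then w $ i
     else grad_G a g R w l $ i + p * sgn (w $ i) * l $ a * \<bar>w $ i\<bar> powr (p - 1))"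

definition reduced_ineq :: "'r \<Rightarrow> (real^'n) \<times> (real^'r) \<Rightarrow> real" where
  "reduced_ineq j = (\<lambda>(w, l). l $ j)"

end

theory Submission
  imports Defs
begin

text \<open>Multiplying the \<open>i\<close>-th reduced equation by \<open>w\<^sub>i\<close> gives the \<open>i\<close>-th constraint of the problem,
  which is moreover void when \<open>w\<^sub>i = 0\<close>. So the reduced system has a smaller feasible set, which
  contains the local optimum, and the constraint qualification supplies multipliers for it. These
  form \<open>\<zeta>\<close> once the ones with index in \<open>I(w\<^sup>*)\<close>, which only affect the stationarity equations
  annihilated by \<open>W\<^sub>*\<^sup>2\<close>, are replaced by 0. The stationarity equations contain the transposed
  Hessian of \<open>G\<close>, hence the need for its symmetry.\<close>

section \<open>Symmetry of the second derivative\<close>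

lemma GDERIV_line:
  assumes "GDERIV f (c + s *\<^sub>R h) :> D"
  shows "DERIV (\<lambda>s. f (c + s *\<^sub>R h)) s :> h \<bullet> D"
proof -
  have "((\<lambda>s. c + s *\<^sub>R h) has_derivative (\<lambda>t. t *\<^sub>R h)) (at s)"
    by (auto intro!: derivative_eq_intros)
  from diff_chain_at[OF this] assms
  have "(f \<circ> (\<lambda>s. c + s *\<^sub>R h) has_derivative (\<lambda>u. u \<bullet> D) \<circ> (\<lambda>t. t *\<^sub>R h)) (at s)"
    unfolding gderiv_def by blast
  then show ?thesis
    by (simp add: has_field_derivative_def o_def mult_commute_abs)
qed

text \<open>The second difference does not change when \<open>h\<close> and \<open>k\<close> are swapped, so its limit exhibits the
  symmetry of the second derivative.\<close>
lemma second_difference_approx: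
  fixes f :: "'a::real_inner \<Rightarrow> real"
  assumes f: "\<And>y. GDERIV f y :> D y" and A: "(D has_derivative A) (at x)" and "e > 0"
  shows "\<exists>d>0. \<forall>t. 0 < t \<and> t < d \<longrightarrow>
    \<bar>f (x + t *\<^sub>R h + t *\<^sub>R k) - f (x + t *\<^sub>R h) - f (x + t *\<^sub>R k) + f x - t\<^sup>2 * (A k \<bullet> h)\<bar> \<le> e * t\<^sup>2"
proof -
  \<comment> \<open>\<open>B\<close> bounds both increments below by \<open>t * B\<close>; the
    summand 1 keeps it positive when \<open>h\<close> and \<open>k\<close> vanish.\<close>
  define B where "B = norm h + norm k + 1"
  have B: "B > 0" "norm h \<le> B" "norm h + norm k \<le> B"
    by (auto simp: B_def add_nonneg_pos)
  \<comment> \<open>Chosen so that the final error \<open>t * (B * (2 * e' * (t * B)))\<close>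
    equals \<open>e * t\<^sup>2\<close>.\<close>
  define e' where "e' = e / (2 * B\<^sup>2)"
  have "e' > 0" using B \<open>e > 0\<close> by (simp add: e'_def)
  have lin: "linear A" using A by (rule has_derivative_linear)
  obtain d where "d > 0"
    and d: "\<And>y. norm (y - x) < d \<Longrightarrow> norm (D y - D x - A (y - x)) \<le> e' * norm (y - x)"
    using A \<open>e' > 0\<close> unfolding has_derivative_at_alt by blast
  have "\<bar>f (x + t *\<^sub>R h + t *\<^sub>R k) - f (x + t *\<^sub>R h) - f (x + t *\<^sub>R k) + f x - t\<^sup>2 * (A k \<bullet> h)\<bar> \<le> e * t\<^sup>2"
    if t: "0 < t" "t < d / B" for t
  proof -
    \<comment> \<open>The second difference is \<open>\<phi> t - \<phi> 0\<close>. The mean value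
      theorem turns it into a difference of two values of \<open>D\<close>, so differentiability of
      \<open>D\<close> at the single point \<open>x\<close> suffices.\<close>
    define \<phi> where "\<phi> s = f ((x + t *\<^sub>R k) + s *\<^sub>R h) - f (x + s *\<^sub>R h)" for s
    have "DERIV \<phi> s :> h \<bullet> D ((x + t *\<^sub>R k) + s *\<^sub>R h) - h \<bullet> D (x + s *\<^sub>R h)" for s
      unfolding \<phi>_def by (intro DERIV_diff GDERIV_line f)
    from MVT2[OF t(1) this]
    obtain \<sigma> where \<sigma>: "0 < \<sigma>" "\<sigma> < t"
      and eq: "\<phi> t - \<phi> 0 = t * (h \<bullet> D ((x + t *\<^sub>R k) + \<sigma> *\<^sub>R h) - h \<bullet> D (x + \<sigma> *\<^sub>R h))"
      by auto
    have tB: "t * B < d" using t B by (simp add: field_simps)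
    have n1: "norm (t *\<^sub>R k + \<sigma> *\<^sub>R h) \<le> t * B"
    proof -
      have "norm (t *\<^sub>R k + \<sigma> *\<^sub>R h) \<le> t * norm k + \<sigma> * norm h"
        using norm_triangle_ineq[of "t *\<^sub>R k" "\<sigma> *\<^sub>R h"] t \<sigma> by simp
      also have "\<dots> \<le> t * norm k + t * norm h" using \<sigma> by (simp add: mult_right_mono)
      also have "\<dots> \<le> t * B" using B(3) t by (simp add: distrib_left[symmetric] add.commute)
      finally show ?thesis .
    qed
    have n2: "norm (\<sigma> *\<^sub>R h) \<le> t * B"
    proof -
      have "norm (\<sigma> *\<^sub>R h) = \<sigma> * norm h" using \<sigma> by simp
      also have "\<dots> \<le> t * B" using \<sigma> B by (intro mult_mono) auto
      finally show ?thesis .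
    qed
    \<comment> \<open>Remainders of the linearization of \<open>D\<close> at \<open>x\<close>. The
      two linear parts share \<open>\<sigma> *\<^sub>R h\<close>, so in the difference only
      \<open>t *\<^sub>R A k\<close> survives and the unknown \<sigma> disappears.\<close>
    define E1 where "E1 = D ((x + t *\<^sub>R k) + \<sigma> *\<^sub>R h) - D x - A (t *\<^sub>R k + \<sigma> *\<^sub>R h)"
    define E2 where "E2 = D (x + \<sigma> *\<^sub>R h) - D x - A (\<sigma> *\<^sub>R h)"
    have "norm E1 \<le> e' * norm (t *\<^sub>R k + \<sigma> *\<^sub>R h)"
      using d[of "(x + t *\<^sub>R k) + \<sigma> *\<^sub>R h"] n1 tB by (simp add: E1_def add.assoc)
    also have "\<dots> \<le> e' * (t * B)" using n1 \<open>e' > 0\<close> by simp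
    finally have E1: "norm E1 \<le> e' * (t * B)" .
    have "norm E2 \<le> e' * norm (\<sigma> *\<^sub>R h)"
      using d[of "x + \<sigma> *\<^sub>R h"] n2 tB by (simp add: E2_def)
    also have "\<dots> \<le> e' * (t * B)" using n2 \<open>e' > 0\<close> by simp
    finally have E2: "norm E2 \<le> e' * (t * B)" .
    have "D ((x + t *\<^sub>R k) + \<sigma> *\<^sub>R h) - D (x + \<sigma> *\<^sub>R h) = E1 - E2 + t *\<^sub>R A k"
      by (simp add: E1_def E2_def linear_add[OF lin] linear_cmul[OF lin])
    then have "\<phi> t - \<phi> 0 = t * (h \<bullet> (E1 - E2 + t *\<^sub>R A k))"
      unfolding eq inner_diff_right[symmetric] by simp
    also have "\<dots> = t * (h \<bullet> (E1 - E2)) + t\<^sup>2 * (A k \<bullet> h)"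
      by (simp add: inner_add_right power2_eq_square distrib_left inner_commute)
    finally have "\<bar>\<phi> t - \<phi> 0 - t\<^sup>2 * (A k \<bullet> h)\<bar> = t * \<bar>h \<bullet> (E1 - E2)\<bar>"
      using t by (simp add: abs_mult)
    also have "\<dots> \<le> t * (B * (2 * e' * (t * B)))"
    proof -
      have "\<bar>h \<bullet> (E1 - E2)\<bar> \<le> norm h * norm (E1 - E2)"
        by (rule Cauchy_Schwarz_ineq2)
      also have "\<dots> \<le> B * (2 * e' * (t * B))"
        using norm_triangle_ineq4[of E1 E2] E1 E2 B by (intro mult_mono) auto
      finally show ?thesis using t by simp
    qed
    also have "\<dots> = e * t\<^sup>2"
      using B by (simp add: e'_def power2_eq_square field_simps)
    finally show ?thesis
      by (simp add: \<phi>_def algebra_simps)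
  qed
  then show ?thesis
    using \<open>d > 0\<close> B by (intro exI[of _ "d / B"]) auto
qed

lemma symmetric_second_derivative:
  fixes f :: "'a::real_inner \<Rightarrow> real"
  assumes f: "\<And>y. GDERIV f y :> D y" and A: "(D has_derivative A) (at x)"
  shows "A h \<bullet> k = A k \<bullet> h"
proof -
  have "\<bar>A h \<bullet> k - A k \<bullet> h\<bar> \<le> e" if "e > 0" for e
  proof -
    have e2: "e / 2 > 0" using that by simp
    obtain d1 where "d1 > 0" and d1: "\<And>t. 0 < t \<Longrightarrow> t < d1 \<Longrightarrow>
      \<bar>f (x + t *\<^sub>R h + t *\<^sub>R k) - f (x + t *\<^sub>R h) - f (x + t *\<^sub>R k) + f x - t\<^sup>2 * (A k \<bullet> h)\<bar> \<le> e/2 * t\<^sup>2"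
      using second_difference_approx[OF f A e2, of h k] by blast
    obtain d2 where "d2 > 0" and d2: "\<And>t. 0 < t \<Longrightarrow> t < d2 \<Longrightarrow>
      \<bar>f (x + t *\<^sub>R k + t *\<^sub>R h) - f (x + t *\<^sub>R k) - f (x + t *\<^sub>R h) + f x - t\<^sup>2 * (A h \<bullet> k)\<bar> \<le> e/2 * t\<^sup>2"
      using second_difference_approx[OF f A e2, of k h] by blast
    define t where "t = min d1 d2 / 2"
    have t: "0 < t" "t < d1" "t < d2" using \<open>d1 > 0\<close> \<open>d2 > 0\<close> by (auto simp: t_def)
    have comm: "x + t *\<^sub>R k + t *\<^sub>R h = x + t *\<^sub>R h + t *\<^sub>R k" by (simp add: algebra_simps)
    have "\<bar>t\<^sup>2 * (A h \<bullet> k) - t\<^sup>2 * (A k \<bullet> h)\<bar> \<le> e * t\<^sup>2"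
      using d1[OF t(1,2)] d2[OF t(1,3)] unfolding comm by linarith
    then have "t\<^sup>2 * \<bar>A h \<bullet> k - A k \<bullet> h\<bar> \<le> t\<^sup>2 * e"
      by (simp add: right_diff_distrib[symmetric] abs_mult mult.commute[of e])
    then show ?thesis using t by simp
  qed
  then have "\<bar>A h \<bullet> k - A k \<bullet> h\<bar> \<le> 0"
    by (rule field_le_epsilon[where y = 0, simplified])
  then show ?thesis by simp
qed

section \<open>Gradients and Hessians of smooth functions\<close>

text \<open>As \<open>grad\<close> is a definite description, computing it needs uniqueness: the
  derivative is unique as a linear map, and inner products with all vectors determine a
  vector.\<close>

lemma grad_eqI:
  assumes "GDERIV f x :> D"
  shows "grad f x = D"
  unfolding grad_def
proof (rule the_equality)
  show "GDERIV f x :> D" by (rule assms)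
next
  fix D' assume "GDERIV f x :> D'"
  then have "(\<lambda>h. h \<bullet> D') = (\<lambda>h. h \<bullet> D)"
    using assms unfolding gderiv_def by (rule has_derivative_unique)
  then show "D' = D"
    by (simp add: fun_eq_iff vector_eq_ldot)
qed

text \<open>A linear functional on a Euclidean space is the inner product with a fixed vector,
  namely its adjoint applied to 1.\<close>

lemma GDERIV_grad:
  fixes f :: "'a::euclidean_space \<Rightarrow> real"
  assumes "f differentiable (at x)"
  shows "GDERIV f x :> grad f x"
proof -
  obtain A where A: "(f has_derivative A) (at x)"
    using assms unfolding differentiable_def by blast
  have "A = (\<lambda>h. h \<bullet> adjoint A 1)"
    using adjoint_works[OF has_derivative_linear[OF A], of _ 1] by auto
  then have "GDERIV f x :> adjoint A 1"
    using A unfolding gderiv_def by simp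
  then show ?thesis
    using grad_eqI by metis
qed

lemma C1_onI:
  assumes "\<And>x. x \<in> U \<Longrightarrow> GDERIV f x :> D x" and "continuous_on U D"
  shows "C1_on U f"
proof -
  have "continuous_on U (grad f)"
    using assms by (subst continuous_on_cong[OF refl, of U _ D]) (auto intro: grad_eqI)
  then show ?thesis
    using assms(1) unfolding C1_on_def gderiv_def differentiable_def by blast
qed

lemma C2_GDERIV: "C2 f \<Longrightarrow> GDERIV f x :> grad f x"
  by (simp add: C2_def C1_on_def GDERIV_grad)

lemma C2_hessian: "C2 f \<Longrightarrow> (grad f has_derivative (\<lambda>h. hessian f x *v h)) (at x)"
  unfolding C2_def hessian_def jacobian_works by blast

lemma hessian_eqI:
  assumes "(grad f has_derivative (\<lambda>h. M *v h)) (at x)"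
  shows "hessian f x = M"
proof -
  have "grad f differentiable (at x)"
    using assms by (rule differentiableI)
  then have "(\<lambda>h. hessian f x *v h) = (\<lambda>h. M *v h)"
    unfolding hessian_def jacobian_works using assms by (rule has_derivative_unique)
  then show ?thesis
    by (simp add: fun_eq_iff matrix_eq)
qed

lemma hessian_symmetric:
  assumes "C2 f"
  shows "hessian f x $ i $ j = hessian f x $ j $ i"
proof -
  \<comment> \<open>Pairing with unit vectors reads off the matrix entries.\<close>
  have "(hessian f x *v axis j 1) \<bullet> axis i 1 = (hessian f x *v axis i 1) \<bullet> axis j 1"
    using C2_GDERIV[OF assms] C2_hessian[OF assms] by (rule symmetric_second_derivative)
  then show ?thesis
    by (simp add: inner_axis matrix_vector_mul_component)
qed

section \<open>Diagonal matrices, sums of matrices and signed powers\<close>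

lemma diag_mult_vec: "diag v *v x = (\<chi> i. v $ i * x $ i)"
  by (simp add: vec_eq_iff diag_def matrix_vector_mult_def if_distrib[of "\<lambda>u. u * _"] cong: if_cong)

lemma sum_matrix_vector_mult: "sum M S *v x = (\<Sum>j\<in>S. M j *v x)"
  by (induction S rule: infinite_finite_induct) (auto simp: matrix_vector_mult_add_rdistrib)

text \<open>Away from 0 the sign is locally constant, so the function agrees near \<open>t\<close>
  with \<open>t powr q\<close> or with \<open>- ((- t) powr q)\<close>. In the second case the two
  minus signs cancel, which gives one formula for both half-lines.\<close>

lemma DERIV_sgn_powr:
  fixes t :: real
  assumes "t \<noteq> 0"
  shows "DERIV (\<lambda>t. sgn t * \<bar>t\<bar> powr q) t :> q * \<bar>t\<bar> powr (q - 1)"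
proof (cases "t > 0")
  case True
  have "DERIV (\<lambda>t. t powr q) t :> q * \<bar>t\<bar> powr (q - 1)"
    using has_real_derivative_powr[of t q] True by simp
  then show ?thesis
    by (rule has_field_derivative_transform_within_open[where S = "{0<..}"]) (use True in auto)
next
  case False
  with assms have "t < 0" by simp
  then have "DERIV (\<lambda>t. - ((- t) powr q)) t :> q * \<bar>t\<bar> powr (q - 1)"
    by (auto intro!: derivative_eq_intros)
  then show ?thesis
    by (rule has_field_derivative_transform_within_open[where S = "{..<0}"]) (use \<open>t < 0\<close> in auto)
qed

section \<open>Differentiability of the reduced constraints in \<open>(w, l)\<close> jointly\<close>

context
  fixes g :: "real^'n \<Rightarrow> real" and R :: "'r::finite \<Rightarrow> real^'n \<Rightarrow> real" and a :: 'r
  assumes g: "C2 g" and R: "\<And>i. i \<noteq> a \<Longrightarrow> C2 (R i)"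
begin

lemma grad_G_eq: "grad_G a g R w l = grad g w + (\<Sum>j\<in>UNIV - {a}. l $ j *\<^sub>R grad (R j) w)"
proof -
  have "((\<lambda>v. G a g R v l) has_derivative
      (\<lambda>h. h \<bullet> grad g w + (\<Sum>j\<in>UNIV - {a}. l $ j * (h \<bullet> grad (R j) w)))) (at w)"
    unfolding G_def
    using C2_GDERIV[OF g, of w] C2_GDERIV[OF R, of _ w] unfolding gderiv_def
    by (intro has_derivative_add has_derivative_sum has_derivative_mult_right) auto
  then show ?thesis
    unfolding grad_G_def
    by (intro grad_eqI) (simp add: gderiv_def inner_add_right inner_sum_right)
qed

lemma hessian_G_eq:
  "hessian (\<lambda>v. G a g R v l) w = hessian g w + (\<Sum>j\<in>UNIV - {a}. l $ j *\<^sub>R hessian (R j) w)"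
proof (rule hessian_eqI)
  have "((\<lambda>v. grad g v + (\<Sum>j\<in>UNIV - {a}. l $ j *\<^sub>R grad (R j) v)) has_derivative
      (\<lambda>h. hessian g w *v h + (\<Sum>j\<in>UNIV - {a}. l $ j *\<^sub>R (hessian (R j) w *v h)))) (at w)"
    using C2_hessian[OF g, of w] C2_hessian[OF R, of _ w]
    by (intro has_derivative_add has_derivative_sum has_derivative_scaleR_right) auto
  moreover have "grad (\<lambda>v. G a g R v l) = (\<lambda>v. grad g v + (\<Sum>j\<in>UNIV - {a}. l $ j *\<^sub>R grad (R j) v))"
    using grad_G_eq unfolding grad_G_def by auto
  ultimately show "(grad (\<lambda>v. G a g R v l) has_derivative
      (\<lambda>h. (hessian g w + (\<Sum>j\<in>UNIV - {a}. l $ j *\<^sub>R hessian (R j) w)) *v h)) (at w)"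
    by (simp add: matrix_vector_mult_add_rdistrib sum_matrix_vector_mult scaleR_matrix_vector_assoc)
qed

text \<open>The first component collects the derivatives in \<open>w\<close>, the second those in
  \<open>l\<close>. Row \<open>i\<close> of each Hessian appears because component \<open>i\<close>
  of a gradient is differentiated.\<close>

definition reduced_grad :: "real \<Rightarrow> 'n \<Rightarrow> (real^'n) \<times> (real^'r) \<Rightarrow> (real^'n) \<times> (real^'r)" where
  "reduced_grad p i z =
     (hessian g (fst z) $ i + (\<Sum>j\<in>UNIV - {a}. snd z $ j *\<^sub>R hessian (R j) (fst z) $ i)
        + (p * (p - 1) * snd z $ a * \<bar>fst z $ i\<bar> powr (p - 2)) *\<^sub>R axis i 1,
      \<chi> j. if j = a then p * sgn (fst z $ i) * \<bar>fst z $ i\<bar> powr (p - 1) else grad (R j) (fst z) $ i)"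

text \<open>The sum and product rules apply, as the equation is affine in \<open>l\<close>. The only
  term that is not smooth everywhere is the signed power, whose singularity is excluded by
  \<open>nz\<close>.\<close>

lemma GDERIV_reduced_eq:
  assumes "i \<notin> I" and nz: "fst z $ i \<noteq> 0"
  shows "GDERIV (reduced_eq a p g R I i) z :> reduced_grad p i z"
proof -
  have fst_i: "((\<lambda>z::(real^'n) \<times> (real^'r). fst z $ i) has_derivative (\<lambda>h. fst h $ i)) (at z)"
    by (intro bounded_linear.has_derivative[OF bounded_linear_vec_nth] has_derivative_fst has_derivative_ident)
  have snd_j: "((\<lambda>z::(real^'n) \<times> (real^'r). snd z $ j) has_derivative (\<lambda>h. snd h $ j)) (at z)" for j
    by (intro bounded_linear.has_derivative[OF bounded_linear_vec_nth] has_derivative_snd has_derivative_ident)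
  have grad_i: "((\<lambda>z::(real^'n) \<times> (real^'r). grad k (fst z) $ i) has_derivative
      (\<lambda>h. hessian k (fst z) $ i \<bullet> fst h)) (at z)" if "C2 k" for k
  proof -
    have "((\<lambda>z::(real^'n) \<times> (real^'r). grad k (fst z)) has_derivative (\<lambda>h. hessian k (fst z) *v fst h)) (at z)"
      using has_derivative_compose[OF has_derivative_fst[OF has_derivative_ident] C2_hessian[OF that]]
      by blast
    from bounded_linear.has_derivative[OF bounded_linear_vec_nth this]
    show ?thesis by (simp add: matrix_vector_mul_component)
  qed
  have pow: "((\<lambda>z::(real^'n) \<times> (real^'r). sgn (fst z $ i) * \<bar>fst z $ i\<bar> powr (p - 1)) has_derivative
      (\<lambda>h. (p - 1) * \<bar>fst z $ i\<bar> powr (p - 2) * fst h $ i)) (at z)"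
    using has_derivative_compose[OF fst_i DERIV_sgn_powr[OF nz, of "p - 1", unfolded has_field_derivative_def]]
    by simp
  have "((\<lambda>z. grad g (fst z) $ i + (\<Sum>j\<in>UNIV - {a}. snd z $ j * grad (R j) (fst z) $ i)
        + p * (snd z $ a * (sgn (fst z $ i) * \<bar>fst z $ i\<bar> powr (p - 1)))) has_derivative
      (\<lambda>h. hessian g (fst z) $ i \<bullet> fst h
        + (\<Sum>j\<in>UNIV - {a}. snd z $ j * (hessian (R j) (fst z) $ i \<bullet> fst h) + snd h $ j * grad (R j) (fst z) $ i)
        + p * (snd z $ a * ((p - 1) * \<bar>fst z $ i\<bar> powr (p - 2) * fst h $ i)
             + snd h $ a * (sgn (fst z $ i) * \<bar>fst z $ i\<bar> powr (p - 1))))) (at z)"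
    by (intro has_derivative_add has_derivative_sum has_derivative_mult has_derivative_mult_right
        grad_i snd_j pow g R) auto
  moreover have "reduced_eq a p g R I i = (\<lambda>z. grad g (fst z) $ i
      + (\<Sum>j\<in>UNIV - {a}. snd z $ j * grad (R j) (fst z) $ i)
      + p * (snd z $ a * (sgn (fst z $ i) * \<bar>fst z $ i\<bar> powr (p - 1))))"
    using \<open>i \<notin> I\<close> by (auto simp: reduced_eq_def grad_G_eq mult_ac)
  moreover have "h \<bullet> reduced_grad p i z = hessian g (fst z) $ i \<bullet> fst h
        + (\<Sum>j\<in>UNIV - {a}. snd z $ j * (hessian (R j) (fst z) $ i \<bullet> fst h) + snd h $ j * grad (R j) (fst z) $ i)
        + p * (snd z $ a * ((p - 1) * \<bar>fst z $ i\<bar> powr (p - 2) * fst h $ i)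
             + snd h $ a * (sgn (fst z $ i) * \<bar>fst z $ i\<bar> powr (p - 1)))" for h
  proof -
    have "snd h \<bullet> snd (reduced_grad p i z) = snd h $ a * (p * sgn (fst z $ i) * \<bar>fst z $ i\<bar> powr (p - 1))
        + (\<Sum>j\<in>UNIV - {a}. snd h $ j * grad (R j) (fst z) $ i)"
      by (simp add: reduced_grad_def inner_vec_def sum.remove[of UNIV a])
    moreover have "fst h \<bullet> fst (reduced_grad p i z) = hessian g (fst z) $ i \<bullet> fst h
        + (\<Sum>j\<in>UNIV - {a}. snd z $ j * (hessian (R j) (fst z) $ i \<bullet> fst h))
        + p * (p - 1) * snd z $ a * \<bar>fst z $ i\<bar> powr (p - 2) * fst h $ i"
      by (simp add: reduced_grad_def inner_add_right inner_sum_right inner_axis inner_commute)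
    ultimately show ?thesis
      by (simp add: inner_prod_def sum.distrib distrib_left mult_ac)
  qed
  ultimately show ?thesis
    by (simp add: gderiv_def)
qed

lemma continuous_on_reduced_grad:
  assumes "\<And>z. z \<in> U \<Longrightarrow> fst z $ i \<noteq> 0"
  shows "continuous_on U (reduced_grad p i)"
proof -
  have hess: "continuous_on U (\<lambda>z::(real^'n) \<times> (real^'r). hessian k (fst z) $ i)" if "C2 k" for k
    using that unfolding C2_def
    by (intro continuous_on_component continuous_on_compose2[OF _ continuous_on_fst[OF continuous_on_id]
        subset_UNIV, of "hessian k"]) auto
  have gr: "continuous_on U (\<lambda>z::(real^'n) \<times> (real^'r). grad k (fst z) $ i)" if "C2 k" for k
    using that unfolding C2_def C1_on_def
    by (intro continuous_on_component continuous_on_compose2[OF _ continuous_on_fst[OF continuous_on_id]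
        subset_UNIV, of "grad k"]) auto
  have fst_i: "continuous_on U (\<lambda>z::(real^'n) \<times> (real^'r). fst z $ i)"
    by (intro continuous_on_component continuous_on_fst continuous_on_id)
  have pow: "continuous_on U (\<lambda>z::(real^'n) \<times> (real^'r). \<bar>fst z $ i\<bar> powr q)" for q
    using assms by (intro continuous_on_powr continuous_on_rabs fst_i continuous_on_const) auto
  have "continuous_on U (\<lambda>z::(real^'n) \<times> (real^'r). if j = a
      then p * sgn (fst z $ i) * \<bar>fst z $ i\<bar> powr (p - 1) else grad (R j) (fst z) $ i)" for j
    using assms
    by (cases "j = a") (auto intro!: continuous_on_mult continuous_on_const continuous_on_sgn fst_i pow gr R)
  then show ?thesis
    unfolding reduced_grad_def
    by (intro continuous_on_Pair continuous_on_vec_lambda continuous_on_add continuous_on_sum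
        continuous_on_scaleR continuous_on_mult continuous_on_const continuous_on_component
        continuous_on_snd continuous_on_id hess pow g R) auto
qed

end

section \<open>Gradients of the coordinate constraints and of the objective on the product
  space\<close>

lemma GDERIV_fst_nth: "GDERIV (\<lambda>(w, l). w $ i) z :> (axis i 1, 0)"
  for z :: "(real^'n) \<times> (real^'r)"
proof -
  have "((\<lambda>z::(real^'n) \<times> (real^'r). fst z $ i) has_derivative (\<lambda>h. fst h $ i)) (at z)"
    by (intro bounded_linear.has_derivative[OF bounded_linear_vec_nth] has_derivative_fst has_derivative_ident)
  then show ?thesis
    by (simp add: gderiv_def inner_prod_def inner_axis case_prod_beta')
qed

lemma GDERIV_reduced_ineq: "GDERIV (reduced_ineq j) z :> (0, axis j 1)"
  for z :: "(real^'n) \<times> (real^'r)"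
proof -
  have "((\<lambda>z::(real^'n) \<times> (real^'r). snd z $ j) has_derivative (\<lambda>h. snd h $ j)) (at z)"
    by (intro bounded_linear.has_derivative[OF bounded_linear_vec_nth] has_derivative_snd has_derivative_ident)
  then show ?thesis
    by (simp add: gderiv_def inner_prod_def inner_axis reduced_ineq_def case_prod_beta')
qed

lemma GDERIV_comp_fst:
  fixes f :: "real^'n \<Rightarrow> real" and z :: "(real^'n) \<times> (real^'r)"
  assumes "C1_on UNIV f"
  shows "GDERIV (\<lambda>(w, l). f w) z :> (grad f (fst z), 0)"
proof -
  have "(f has_derivative (\<lambda>h. h \<bullet> grad f (fst z))) (at (fst z))"
    using assms GDERIV_grad unfolding C1_on_def gderiv_def by blast
  from has_derivative_compose[OF has_derivative_fst[OF has_derivative_ident] this]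
  show ?thesis
    by (simp add: gderiv_def inner_prod_def case_prod_beta')
qed

section \<open>From multipliers of the reduced system to the SB-KKT conditions\<close>

theorem theorem2:
  fixes f g :: "real^'n \<Rightarrow> real"
    and R :: "'r::finite \<Rightarrow> real^'n \<Rightarrow> real"
    and a :: 'r
    and p :: real
    and ws :: "real^'n" and ls :: "real^'r"
    and Q :: "('n \<Rightarrow> (real^'n) \<times> (real^'r) \<Rightarrow> real) \<Rightarrow> ('r \<Rightarrow> (real^'n) \<times> (real^'r) \<Rightarrow> real) \<Rightarrow>
                (real^'n) \<times> (real^'r) \<Rightarrow> bool"
  assumes p: "0 < p" "p \<le> 1"
    and f: "C1_on UNIV f"
    and g: "C2 g"
    and R: "\<And>i. i \<noteq> a \<Longrightarrow> C2 (R i)"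
    and opt: "local_minimizer (\<lambda>(w, l). f w) (problem_feasible a p g R) (ws, ls)"
    and cq: "constraint_qualification Q"
    and cq_holds: "Q (reduced_eq a p g R (zero_set ws)) reduced_ineq (ws, ls)"
  shows "\<exists>(\<zeta> :: real^'n) (\<eta> :: real^'r).
      diag ws ** diag ws *v grad f ws + H a p g R ws ls *v \<zeta> = 0 \<and>
      diag ws *v grad_G a g R ws ls + (p * ls $ a) *\<^sub>R abs_powr ws p = 0 \<and>
      p * (\<Sum>i\<in>UNIV - zero_set ws. sgn (ws $ i) * \<bar>ws $ i\<bar> powr (p - 1) * \<zeta> $ i) = \<eta> $ a \<and>
      (\<forall>i\<in>zero_set ws. \<zeta> $ i = 0) \<and>
      (\<forall>i. i \<noteq> a \<longrightarrow> grad (R i) ws \<bullet> \<zeta> = \<eta> $ i) \<and>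
      0 \<le> ls \<and> 0 \<le> \<eta> \<and> ls \<bullet> \<eta> = 0"
proof -
  define I where "I = zero_set ws"
  define h where "h = reduced_eq a p g R I"
  \<comment> \<open>The neighbourhood on which the system is continuously differentiable: no
    component that is nonzero at \<open>ws\<close> vanishes there, while those in \<open>I\<close>
    are unrestricted.\<close>
  define U where "U = (\<Inter>i\<in>- I. {z :: (real^'n) \<times> (real^'r). fst z $ i \<noteq> 0})"
  note rg_eq = GDERIV_reduced_eq[of g a R, OF g R]
  have nz: "ws $ i \<noteq> 0" if "i \<notin> I" for i using that by (simp add: I_def zero_set_def)
  have z: "ws $ i = 0" if "i \<in> I" for i using that by (simp add: I_def zero_set_def)
  have problem: "diag ws *v grad_G a g R ws ls + (p * ls $ a) *\<^sub>R abs_powr ws p = 0" "0 \<le> ls"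
    using opt by (auto simp: local_minimizer_def problem_feasible_def)
  have abs_powr_split: "\<bar>x\<bar> powr p = x * (sgn x * \<bar>x\<bar> powr (p - 1))" for x :: real
  proof (cases "x = 0")
    case False
    then have "\<bar>x\<bar> powr p = \<bar>x\<bar> powr (p - 1) * \<bar>x\<bar>"
      by (simp add: powr_diff)
    also have "\<dots> = x * (sgn x * \<bar>x\<bar> powr (p - 1))"
      by (simp add: abs_sgn[of x])
    finally show ?thesis .
  qed simp
  have complementarity_nth: "(diag w *v grad_G a g R w l + (p * l $ a) *\<^sub>R abs_powr w p) $ i
      = w $ i * (grad_G a g R w l $ i + p * sgn (w $ i) * l $ a * \<bar>w $ i\<bar> powr (p - 1))" for w l i
    by (simp add: diag_mult_vec abs_powr_def abs_powr_split[of "w $ i"] algebra_simps)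
  have "feasible_set h reduced_ineq \<subseteq> problem_feasible a p g R"
  proof clarify
    fix w l assume feas: "(w, l) \<in> feasible_set h reduced_ineq"
    have "0 \<le> l"
      using feas by (simp add: feasible_set_def reduced_ineq_def less_eq_vec_def)
    \<comment> \<open>For \<open>i\<close> in \<open>I\<close> the first factor vanishes, otherwise
      the second one does.\<close>
    moreover have "w $ i * (grad_G a g R w l $ i + p * sgn (w $ i) * l $ a * \<bar>w $ i\<bar> powr (p - 1)) = 0" for i
    proof -
      have "h i (w, l) = 0" using feas by (simp add: feasible_set_def)
      then show ?thesis by (auto simp: h_def reduced_eq_def split: if_splits)
    qed
    ultimately show "(w, l) \<in> problem_feasible a p g R"
      by (simp add: problem_feasible_def vec_eq_iff[of _ 0] complementarity_nth del: vector_add_component)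
  qed
  moreover have feas: "(ws, ls) \<in> feasible_set h reduced_ineq"
  proof -
    \<comment> \<open>Outside \<open>I\<close> the nonzero factor \<open>ws $ i\<close> of the
      original constraint can be cancelled.\<close>
    have "h i (ws, ls) = 0" for i
      using complementarity_nth[of ws ls i] problem(1) nz[of i] z[of i]
      by (cases "i \<in> I") (auto simp: h_def reduced_eq_def)
    then show ?thesis
      using problem(2) by (simp add: feasible_set_def reduced_ineq_def less_eq_vec_def)
  qed
  ultimately have min: "local_minimizer (\<lambda>(w, l). f w) (feasible_set h reduced_ineq) (ws, ls)"
    using opt unfolding local_minimizer_def by blast
  have grad_I: "GDERIV (h i) y :> (axis i 1, 0)" if "i \<in> I" for i y
    using GDERIV_fst_nth[of i y] that by (simp add: h_def reduced_eq_def)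
  have grad_not_I: "GDERIV (h i) y :> reduced_grad g R a p i y" if "i \<notin> I" "fst y $ i \<noteq> 0" for i y
    unfolding h_def using that by (intro rg_eq) auto
  have "KKT (\<lambda>(w, l). f w) h reduced_ineq (ws, ls)"
  proof -
    have "open U"
      unfolding U_def by (intro open_INT finite ballI open_Collect_neq continuous_intros)
    moreover have "(ws, ls) \<in> U" using nz by (auto simp: U_def)
    moreover have "C1_on U (h i)" for i
    proof (cases "i \<in> I")
      case True
      show ?thesis by (rule C1_onI[OF grad_I[OF True] continuous_on_const])
    next
      case False
      then show ?thesis
        by (intro C1_onI[where D = "reduced_grad g R a p i"] grad_not_I continuous_on_reduced_grad g R)
          (auto simp: U_def)
    qed
    moreover have "C1_on U (reduced_ineq j)" for j :: 'r
      by (rule C1_onI[OF GDERIV_reduced_ineq continuous_on_const])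
    moreover have "C1_on UNIV (\<lambda>(w, l :: real^'r). f w)"
      using f[unfolded C1_on_def, THEN conjunct2]
      by (intro C1_onI[OF GDERIV_comp_fst[OF f]] continuous_on_Pair continuous_on_const
          continuous_on_compose2[OF _ continuous_on_fst[OF continuous_on_id] subset_UNIV, of "grad f"])
    ultimately show ?thesis
      using cq feas min cq_holds unfolding constraint_qualification_def h_def I_def by blast
  qed
  then obtain \<mu> \<nu> where stat: "grad (\<lambda>(w, l). f w) (ws, ls) + (\<Sum>i\<in>UNIV. \<mu> i *\<^sub>R grad (h i) (ws, ls))
        - (\<Sum>j\<in>UNIV. \<nu> j *\<^sub>R grad (reduced_ineq j) (ws, ls)) = 0"
    and \<nu>: "\<And>j. 0 \<le> \<nu> j" "\<And>j. \<nu> j * reduced_ineq j (ws, ls) = 0"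
    unfolding KKT_def by blast
  define \<zeta> :: "real^'n" where "\<zeta> = (\<chi> i. if i \<in> I then 0 else \<mu> i)"
  \<comment> \<open>As \<eta> consists of the multipliers of \<open>0 \<le> l\<close>, its sign and
    complementarity conditions are those of KKT.\<close>
  define \<eta> :: "real^'r" where "\<eta> = (\<chi> j. \<nu> j)"
  define A where "A = hessian (\<lambda>v. G a g R v ls) ws"
  have A_eq: "A = hessian g ws + (\<Sum>j\<in>UNIV - {a}. ls $ j *\<^sub>R hessian (R j) ws)"
    unfolding A_def by (rule hessian_G_eq[OF g R])
  \<comment> \<open>Stationarity combines the rows \<open>A $ i\<close> with weights
    \<open>\<zeta> $ i\<close>, which is the transpose of \<open>A\<close> applied to \<zeta>,
    whereas \<open>H\<close> requires \<open>A *v \<zeta>\<close>.\<close>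
  have A_sym: "A $ i $ k = A $ k $ i" for i k
    unfolding A_eq using hessian_symmetric[OF g, of ws i k] hessian_symmetric[OF R, of _ ws i k]
    by (auto intro!: sum.cong)
  define B :: "'n \<Rightarrow> real^'r" where "B i = (\<chi> j. if j = a then p * sgn (ws $ i) * \<bar>ws $ i\<bar> powr (p - 1)
      else grad (R j) ws $ i)" for i
  define d where "d i = p * (p - 1) * ls $ a * \<bar>ws $ i\<bar> powr (p - 2)" for i
  have grad_h: "grad (h i) (ws, ls) = (if i \<in> I then (axis i 1, 0) else (A $ i + d i *\<^sub>R axis i 1, B i))" for i
    using grad_eqI[OF grad_I] grad_eqI[OF grad_not_I, of i "(ws, ls)"] nz[of i]
    by (auto simp: reduced_grad_def[OF g R] A_eq B_def d_def)
  have split: "(\<Sum>i\<in>UNIV. \<mu> i *\<^sub>R grad (h i) (ws, ls))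
      = (\<Sum>i\<in>I. \<mu> i *\<^sub>R (axis i 1, 0)) + (\<Sum>i\<in>- I. \<zeta> $ i *\<^sub>R (A $ i + d i *\<^sub>R axis i 1, B i))"
  proof -
    have "(\<Sum>i\<in>UNIV. \<mu> i *\<^sub>R grad (h i) (ws, ls))
        = (\<Sum>i\<in>I. \<mu> i *\<^sub>R grad (h i) (ws, ls)) + (\<Sum>i\<in>- I. \<mu> i *\<^sub>R grad (h i) (ws, ls))"
      using sum.union_disjoint[of I "- I"] by simp
    also have "\<dots> = (\<Sum>i\<in>I. \<mu> i *\<^sub>R (axis i 1, 0)) + (\<Sum>i\<in>- I. \<zeta> $ i *\<^sub>R (A $ i + d i *\<^sub>R axis i 1, B i))"
      by (intro arg_cong2[of _ _ _ _ "(+)"] sum.cong) (auto simp: grad_h \<zeta>_def)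
    finally show ?thesis .
  qed
  have stat_w: "grad f ws + (\<Sum>i\<in>I. \<mu> i *\<^sub>R axis i 1) + (\<Sum>i\<in>- I. \<zeta> $ i *\<^sub>R (A $ i + d i *\<^sub>R axis i 1)) = 0"
    using arg_cong[OF stat, of fst]
    by (simp add: split grad_eqI[OF GDERIV_comp_fst[OF f]] grad_eqI[OF GDERIV_reduced_ineq] fst_sum add.assoc)
  \<comment> \<open>In the \<open>l\<close> component the objective and the constraints with index
    in \<open>I\<close> contribute nothing, and the gradients of the inequalities are unit
    vectors.\<close>
  have stat_l: "(\<Sum>i\<in>- I. \<zeta> $ i *\<^sub>R B i) = \<eta>"
  proof -
    have "(\<Sum>i\<in>- I. \<zeta> $ i *\<^sub>R B i) = (\<Sum>j\<in>UNIV. \<nu> j *\<^sub>R axis j 1)"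
      using arg_cong[OF stat, of snd]
      by (simp add: split grad_eqI[OF GDERIV_comp_fst[OF f]] grad_eqI[OF GDERIV_reduced_ineq] snd_sum)
    also have "\<dots> = \<eta>"
      by (simp add: vec_eq_iff \<eta>_def axis_def if_distrib[of "\<lambda>u. _ * u"] cong: if_cong)
    finally show ?thesis .
  qed
  \<comment> \<open>Since \<zeta> vanishes on \<open>I\<close>, sums over its complement extend to
    all indices, as in matrix-vector and inner products.\<close>
  have sum_I: "(\<Sum>i\<in>- I. F i * \<zeta> $ i) = (\<Sum>i\<in>UNIV. F i * \<zeta> $ i)" for F
    by (rule sum.mono_neutral_left) (auto simp: \<zeta>_def)
  have stationarity: "diag ws ** diag ws *v grad f ws + H a p g R ws ls *v \<zeta> = 0"
  proof -
    have "ws $ k * (ws $ k * grad f ws $ k) + (ws $ k * (ws $ k * (A *v \<zeta>) $ k)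
        + ls $ a * p * (p - 1) * (\<bar>ws $ k\<bar> powr p * \<zeta> $ k)) = 0" for k
    proof (cases "k \<in> I")
      case True
      then show ?thesis by (simp add: z)
    next
      case False
      have "(\<Sum>i\<in>I. \<mu> i *\<^sub>R axis i (1::real)) $ k = 0"
        using False by (auto simp: axis_def intro!: sum.neutral)
      moreover have "(\<Sum>i\<in>- I. \<zeta> $ i *\<^sub>R (A $ i + d i *\<^sub>R axis i 1)) $ k = (A *v \<zeta>) $ k + d k * \<zeta> $ k"
      proof -
        have "(\<Sum>i\<in>- I. \<zeta> $ i *\<^sub>R (A $ i + d i *\<^sub>R axis i 1)) $ k
            = (\<Sum>i\<in>- I. (A $ k $ i + (if i = k then d i else 0)) * \<zeta> $ i)"
          by (auto simp: axis_def A_sym[of _ k] intro!: sum.cong)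
        also have "\<dots> = (\<Sum>i\<in>UNIV. (A $ k $ i + (if i = k then d i else 0)) * \<zeta> $ i)"
          by (rule sum_I)
        also have "\<dots> = (A *v \<zeta>) $ k + d k * \<zeta> $ k"
          by (simp add: distrib_right sum.distrib matrix_vector_mult_def if_distrib[of "\<lambda>u. u * _"] cong: if_cong)
        finally show ?thesis .
      qed
      ultimately have "grad f ws $ k + ((A *v \<zeta>) $ k + d k * \<zeta> $ k) = 0"
        using arg_cong[OF stat_w, of "\<lambda>v. v $ k"] by simp
      \<comment> \<open>The factor \<open>(ws $ k)\<^sup>2\<close> raises the exponent from
        \<open>p - 2\<close> to \<open>p\<close>, which produces the diagonal term of
        \<open>H\<close>.\<close>
      moreover have "ws $ k * (ws $ k * d k) = ls $ a * p * (p - 1) * \<bar>ws $ k\<bar> powr p"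
      proof -
        have "\<bar>ws $ k\<bar> powr (p - 2) = \<bar>ws $ k\<bar> powr p / (ws $ k)\<^sup>2"
          using nz[OF False] by (simp add: powr_diff)
        then show ?thesis
          using nz[OF False] by (simp add: d_def power2_eq_square)
      qed
      ultimately show ?thesis by algebra
    qed
    then show ?thesis
      by (simp add: vec_eq_iff H_def A_def[symmetric] matrix_vector_mult_add_rdistrib diag_mult_vec abs_powr_def
          flip: matrix_vector_mul_assoc scaleR_matrix_vector_assoc)
  qed
  moreover have "p * (\<Sum>i\<in>UNIV - zero_set ws. sgn (ws $ i) * \<bar>ws $ i\<bar> powr (p - 1) * \<zeta> $ i) = \<eta> $ a"
    by (simp add: stat_l[symmetric] B_def I_def Compl_eq_Diff_UNIV sum_distrib_left mult_ac)
  moreover have "grad (R j) ws \<bullet> \<zeta> = \<eta> $ j" if "j \<noteq> a" for j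
    using that sum_I[of "\<lambda>i. grad (R j) ws $ i"]
    by (simp add: stat_l[symmetric] B_def inner_vec_def mult_ac)
  moreover have "\<forall>i\<in>zero_set ws. \<zeta> $ i = 0"
    by (simp add: \<zeta>_def I_def)
  moreover have "0 \<le> \<eta>" "ls \<bullet> \<eta> = 0"
    using \<nu> by (auto simp: \<eta>_def less_eq_vec_def inner_vec_def reduced_ineq_def mult.commute intro!: sum.neutral)
  ultimately show ?thesis
    using problem by blast
qed

end
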